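(* There is a universal constant $c>0$ such that the following holds for every integer $d\ge 1$. There is an instance space $\mathcal{X}$ such that, if $\mathcal{F}$ denotes the family of all concept classes $\mathcal{C}\subseteq\{0,1\}^{\mathcal{X}}$ with Littlestone dimension $d$, then for all sufficiently large $T$ (depending on $d$), every (possibly randomized) online learner $\mathcal{A}$ in the agnostic setting whose access to the concept class is through the agnostic ERM oracle and which makes a finite number of oracle queries satisfies $$\mathrm{Reg}(\mathcal{A},T)\ \ge\ c\,\sqrt{T\,2^{d}},$$ i.e. it incurs $\Omega(\sqrt{T2^{d}})$ expected regret in the worst case.
   Context: Agnostic online learning with oracle access. Let $\mathcal{X}$ be an instance space and $\mathcal{F}$ a family of (nonempty) concept classes $\mathcal{C}\subseteq\{0,1\}^{\mathcal{X}}$. The learner knows $\mathcal{X}$, $\mathcal{F}$ and the horizon $T$. An oblivious adversary fixes in advance an unknown class $\mathcal{C}\in\mathcal{F}$ and an arbitrary sequence $(x_{1:T},y_{1:T})\in(\mathcal{X}\times\{0,1\})^T$ (not necessarily realizable). The learner can access $\mathcal{C}$ only by querying an oracle $\mathcal{O}=\mathcal{O}(\mathcal{C})$. In round $t=1,\dots,T$: the learner observes $x_t$, may make oracle queries, picks a distribution on $\{0,1\}$ and predicts $\hat y_t$ drawn from it; then $y_t$ is revealed. The regret is $$\mathrm{Reg}(\mathcal{A},\mathcal{O}(\mathcal{C}),(x_{1:T},y_{1:T}))=\sum_{t=1}^T\mathbb{I}[\hat y_t\ne y_t]-\inf_{c\in\mathcal{C}}\sum_{t=1}^T\mathbb{I}[c(x_t)\ne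 y_t],$$ and $\mathrm{Reg}(\mathcal{A},T)=\sup_{\mathcal{C}\in\mathcal{F}}\sup_{(x,y)\in(\mathcal{X}\times\{0,1\})^T}\mathbb{E}[\mathrm{Reg}(\mathcal{A},\mathcal{O}(\mathcal{C}),(x,y))]$, the expectation being over the learner's randomness. Agnostic ERM oracle: given any finite $S\subset\mathcal{X}\times\{0,1\}$, it returns some $c'\in\mathcal{C}$ minimizing $\sum_{(x,y)\in S}\mathbb{I}[c'(x)\ne y]$ over $\mathcal{C}$. When several answers are valid, the choice may be made adversarially, i.e. worst-case quantities are also worst case over valid oracles. Littlestone dimension of $\mathcal{C}$: the largest depth $n$ of a complete binary tree whose internal nodes are labeled by points of $\mathcal{X}$ such that for every root-to-leaf path, with edge labels $y_1,\dots,y_n\in\{0,1\}$ and visited nodes $x_1,\dots,x_n$, some $c\in\mathcal{C}$ has $c(x_i)=y_i$ for all $i$. *)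

theory Defs
  imports "HOL-Probability.Probability" "HOL-Library.Extended_Nat"
begin

text \<open>
  Labels are booleans.  A concept on the instance space \<open>X\<close> is an element of
  \<open>X \<rightarrow>\<^sub>E UNIV\<close>, so that concepts are determined by their values on \<open>X\<close>.
\<close>

type_synonym 'x concept = "'x \<Rightarrow> bool"
type_synonym 'x sample = "('x \<times> bool) set"


section \<open>Littlestone dimension\<close>

text \<open>
  A complete binary tree of depth \<open>n\<close> is encoded by the function \<open>v\<close> which maps the list of edge
  labels leading from the root to an internal node to the instance labelling that node.
\<close>

definition shatters_tree :: "'x concept set \<Rightarrow> nat \<Rightarrow> (bool list \<Rightarrow> 'x) \<Rightarrow> bool" where
  "shatters_tree C n v \<longleftrightarrow>
     (\<forall>ys. length ys = n \<longrightarrow> (\<exists>c\<in>C. \<forall>i<n. c (v (take i ys)) = ys ! i))"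

definition littlestone_dim :: "'x set \<Rightarrow> 'x concept set \<Rightarrow> enat" where
  "littlestone_dim X C =
     Sup {enat n | n. \<exists>v. (\<forall>p. length p < n \<longrightarrow> v p \<in> X) \<and> shatters_tree C n v}"

definition littlestone_classes :: "'x set \<Rightarrow> nat \<Rightarrow> 'x concept set set" where
  "littlestone_classes X d =
     {C. C \<subseteq> (X \<rightarrow>\<^sub>E UNIV) \<and> C \<noteq> {} \<and> littlestone_dim X C = enat d}"


section \<open>The agnostic ERM oracle\<close>

definition empirical_error :: "'x sample \<Rightarrow> 'x concept \<Rightarrow> nat" where
  "empirical_error S c = (\<Sum>(x, y)\<in>S. of_bool (c x \<noteq> y))"

text \<open>
  An oracle is a fixed choice of one minimizer for every admissible query; the worst case over the
  choice of minimizers is taken in the definition of the regret of a learner.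
\<close>

definition erm_oracles :: "'x set \<Rightarrow> 'x concept set \<Rightarrow> ('x sample \<Rightarrow> 'x concept) set" where
  "erm_oracles X C =
     {orc. \<forall>S. finite S \<and> S \<subseteq> X \<times> UNIV \<longrightarrow> is_arg_min (empirical_error S) (\<lambda>c. c \<in> C) (orc S)}"


section \<open>Randomized learners with oracle access\<close>

text \<open>
  A transcript lists, in chronological order, everything the learner has seen or done so far.
\<close>

datatype 'x event =
    Instance 'x
  | Answer "'x sample" "'x concept"
  | Prediction bool
  | Label bool

type_synonym 'x transcript = "'x event list"

text \<open>
  Within a round, \<open>next_query\<close> chooses at random either the next query or, by \<open>None\<close>, to stop
  querying; \<open>predict\<close> is then the distribution from which the prediction is drawn.
  All randomness is drawn afresh at each step.  This does not restrict the learner if \<open>X\<close> is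
  countable: there are then only countably many possible actions at each step, and
  since the transcript contains all past actions, conditioning on it turns any learner with private
  random bits into one of this form with the same distribution of transcripts.
\<close>

datatype 'x learner = Learner
  (next_query: "'x transcript \<Rightarrow> 'x sample option pmf")
  (predict: "'x transcript \<Rightarrow> bool pmf")

definition admissible_learner :: "'x set \<Rightarrow> 'x learner \<Rightarrow> bool" where
  "admissible_learner X A \<longleftrightarrow>
     (\<forall>h S. Some S \<in> set_pmf (next_query A h) \<longrightarrow> finite S \<and> S \<subseteq> X \<times> UNIV)"

partial_function (spmf) query_phase ::
  "'x learner \<Rightarrow> ('x sample \<Rightarrow> 'x concept) \<Rightarrow> 'x transcript \<Rightarrow> 'x transcript spmf" where
  "query_phase A orc h =
     bind_spmf (spmf_of_pmf (next_query A h))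
       (\<lambda>q. case q of
          None \<Rightarrow> return_spmf h
        | Some S \<Rightarrow> query_phase A orc (h @ [Answer S (orc S)]))"

text \<open>
  The joint distribution of the predictions on the sequence \<open>zs\<close>, when the past transcript is
  \<open>h\<close>.  The mass missing to 1 is the probability that the learner keeps querying forever.
\<close>

primrec play ::
  "'x learner \<Rightarrow> ('x sample \<Rightarrow> 'x concept) \<Rightarrow> 'x transcript \<Rightarrow> ('x \<times> bool) list \<Rightarrow> bool list spmf"
where
  "play A orc h [] = return_spmf []"
| "play A orc h (z # zs) =
     bind_spmf (query_phase A orc (h @ [Instance (fst z)]))
       (\<lambda>h'. bind_spmf (spmf_of_pmf (predict A h'))
          (\<lambda>b. map_spmf ((#) b) (play A orc (h' @ [Prediction b, Label (snd z)]) zs)))"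

definition sequences :: "'x set \<Rightarrow> nat \<Rightarrow> ('x \<times> bool) list set" where
  "sequences X T = {zs. length zs = T \<and> set zs \<subseteq> X \<times> UNIV}"

text \<open>
  The number of queries is only required to be finite almost surely; no bound on it is assumed.
\<close>

definition finitely_many_queries ::
  "'x set \<Rightarrow> 'x concept set set \<Rightarrow> nat \<Rightarrow> 'x learner \<Rightarrow> bool" where
  "finitely_many_queries X F T A \<longleftrightarrow>
     (\<forall>C\<in>F. \<forall>orc\<in>erm_oracles X C. \<forall>zs\<in>sequences X T. lossless_spmf (play A orc [] zs))"


section \<open>Regret\<close>

definition regret :: "'x concept set \<Rightarrow> ('x \<times> bool) list \<Rightarrow> bool list \<Rightarrow> real" where
  "regret C zs bs =
     (\<Sum>t<length zs. of_bool (bs ! t \<noteq> snd (zs ! t)))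
     - (INF c\<in>C. \<Sum>t<length zs. of_bool (c (fst (zs ! t)) \<noteq> snd (zs ! t)))"

definition expected_regret ::
  "'x learner \<Rightarrow> 'x concept set \<Rightarrow> ('x sample \<Rightarrow> 'x concept) \<Rightarrow> ('x \<times> bool) list \<Rightarrow> real" where
  "expected_regret A C orc zs = (LINT bs|measure_spmf (play A orc [] zs). regret C zs bs)"

definition worst_case_regret ::
  "'x set \<Rightarrow> 'x concept set set \<Rightarrow> nat \<Rightarrow> 'x learner \<Rightarrow> ereal" where
  "worst_case_regret X F T A =
     (SUP C\<in>F. SUP orc\<in>erm_oracles X C. SUP zs\<in>sequences X T. ereal (expected_regret A C orc zs))"

end

theory Submission
  imports Defs "HOL-Library.Sublist"
begin

text \<open>
  A class with fewer than \<open>2 ^ Suc d\<close> concepts has Littlestone dimension at most \<open>d\<close>.  There is thus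
  room for a cube of \<open>2 ^ d\<close> concepts, which makes the dimension equal to \<open>d\<close>, and for
  \<open>n = 2 ^ (d - 1)\<close> further concepts: the \<open>i\<close>-th one has the secret labels \<open>b j\<close> at the points
  \<open>x j\<close> with \<open>j < i\<close>, label 1 at \<open>x i\<close>, and label 0 elsewhere.  On samples that avoid
  \<open>x k, x (k + 1), \<dots>\<close>, all concepts from the \<open>k\<close>-th one on agree with some earlier concept, so an
  oracle which prefers early concepts reveals neither these points nor \<open>b (k - 1), b k, \<dots>\<close>.
  The adversary presents each \<open>x i\<close> for a block of about \<open>T / n\<close> rounds with uniformly random labels,
  and \<open>b i\<close> is the majority label of block \<open>i\<close>.  If every \<open>x i\<close> is chosen so that the learner is
  unlikely to query it before its block, then the learner errs half of the time, while the
  concept with all the majority labels gains an expected \<open>\<Omega>(sqrt (T / n))\<close> per block.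
\<close>

section \<open>Classes whose oracle hides later points\<close>

text \<open>Label sequences that agree up to depth \<open>i\<close> meet the same node there, so a
  concept that serves both forces their next labels to agree as well. Choosing one concept per
  sequence is therefore injective.\<close>

lemma shatters_tree_card:
  assumes "shatters_tree C n v" "finite C"
  shows "2 ^ n \<le> card C"
proof -
  let ?L = "{ys :: bool list. length ys = n}"
  obtain g where g: "\<And>ys. length ys = n \<Longrightarrow> g ys \<in> C \<and> (\<forall>i<n. g ys (v (take i ys)) = ys ! i)"
    using assms(1) unfolding shatters_tree_def by metis
  have "inj_on g ?L"
  proof (rule inj_onI)
    fix ys ys' assume L: "ys \<in> ?L" "ys' \<in> ?L" and eq: "g ys = g ys'"
    have "take i ys = take i ys'" if "i \<le> n" for i
      using that
    proof (induction i)
      case (Suc i)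
      then have "i < n" by simp
      then have "ys ! i = g ys (v (take i ys))" "ys' ! i = g ys' (v (take i ys'))"
        using g[of ys] g[of ys'] L by auto
      then have "ys ! i = ys' ! i" using Suc eq by simp
      with Suc L show ?case by (simp add: take_Suc_conv_app_nth)
    qed simp
    from this[of n] show "ys = ys'" using L by simp
  qed
  then have "card ?L \<le> card C" using g assms(2) by (intro card_inj_on_le[of g]) auto
  then show ?thesis using card_lists_length_eq[of "UNIV :: bool set" n] by simp
qed

lemma littlestone_dim_eqI:
  assumes "finite C" "card C < 2 ^ Suc d" "\<And>p. length p < d \<Longrightarrow> v p \<in> X" "shatters_tree C d v"
  shows "littlestone_dim X C = enat d"
  unfolding littlestone_dim_def
proof (rule antisym)
  show "Sup {enat n |n. \<exists>v. (\<forall>p. length p < n \<longrightarrow> v p \<in> X) \<and> shatters_tree C n v} \<le> enat d"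
  proof (rule Sup_least, clarify)
    fix n v assume "shatters_tree C n v"
    then have "(2::nat) ^ n < 2 ^ Suc d" using shatters_tree_card assms(1,2) le_less_trans by blast
    then have "n < Suc d" by (rule power_less_imp_less_exp[rotated]) simp
    then show "enat n \<le> enat d" by simp
  qed
next
  have "enat d \<in> {enat n |n. \<exists>v. (\<forall>p. length p < n \<longrightarrow> v p \<in> X) \<and> shatters_tree C n v}"
    using assms(3,4) by blast
  then show "enat d \<le> Sup {enat n |n. \<exists>v. (\<forall>p. length p < n \<longrightarrow> v p \<in> X) \<and> shatters_tree C n v}"
    by (rule Sup_upper)
qed

section \<open>The hard class, its target concept and its oracle\<close>

definition level :: "(nat \<Rightarrow> nat) \<Rightarrow> (nat \<Rightarrow> bool) \<Rightarrow> nat \<Rightarrow> nat concept" where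
  "level x b i = (\<lambda>p. p = x i \<or> (\<exists>j<i. p = x j \<and> b j))"

definition target :: "(nat \<Rightarrow> nat) \<Rightarrow> (nat \<Rightarrow> bool) \<Rightarrow> nat \<Rightarrow> nat concept" where
  "target x b k = (\<lambda>p. \<exists>j<k. p = x j \<and> b j)"

definition cube :: "nat \<Rightarrow> nat concept set" where
  "cube d = (\<lambda>B p. p \<in> B) ` Pow {..<d}"

definition hard_class :: "nat \<Rightarrow> (nat \<Rightarrow> nat) \<Rightarrow> (nat \<Rightarrow> bool) \<Rightarrow> nat \<Rightarrow> nat concept set" where
  "hard_class d x b k = cube d \<union> level x b ` {..<k}"

lemma hard_class_Suc: "hard_class d x b (Suc k) = insert (level x b k) (hard_class d x b k)"
  by (auto simp: hard_class_def lessThan_Suc)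

lemma finite_hard_class [simp]: "finite (hard_class d x b k)"
  by (simp add: hard_class_def cube_def)

text \<open>With \<open>k < 2 ^ d\<close> levels added to the cube, the class stays below
  \<open>2 ^ Suc d\<close> concepts. The tree with the point \<open>i\<close> at every node of depth
  \<open>i\<close>, given by \<open>length\<close>, is shattered by the cube alone.\<close>

lemma hard_class_in_littlestone_classes:
  assumes "k < 2 ^ d"
  shows "hard_class d x b k \<in> littlestone_classes UNIV d"
proof -
  have "card (hard_class d x b k) \<le> 2 ^ d + k"
  proof -
    have "card (cube d) \<le> 2 ^ d"
      unfolding cube_def using card_image_le[of "Pow {..<d}"] by (simp add: card_Pow)
    moreover have "card (level x b ` {..<k}) \<le> k" using card_image_le[of "{..<k}"] by simp
    ultimately show ?thesis
      unfolding hard_class_def using card_Un_le[of "cube d" "level x b ` {..<k}"] by linarith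
  qed
  then have card: "card (hard_class d x b k) < 2 ^ Suc d" using assms by simp
  have "shatters_tree (hard_class d x b k) d length"
    unfolding shatters_tree_def
  proof (intro allI impI)
    fix ys :: "bool list" assume "length ys = d"
    define B where "B = {i. i < d \<and> ys ! i}"
    have "(\<lambda>p. p \<in> B) \<in> cube d" unfolding cube_def by (rule imageI) (auto simp: B_def)
    then have "(\<lambda>p. p \<in> B) \<in> hard_class d x b k" by (simp add: hard_class_def)
    moreover have "\<forall>i<d. (length (take i ys) \<in> B) = ys ! i"
      using \<open>length ys = d\<close> by (simp add: B_def)
    ultimately show "\<exists>c\<in>hard_class d x b k. \<forall>i<d. c (length (take i ys)) = ys ! i"
      by (intro bexI[of _ "\<lambda>p. p \<in> B"])
  qed
  with card have "littlestone_dim UNIV (hard_class d x b k) = enat d"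
    by (intro littlestone_dim_eqI[where v = length]) simp_all
  moreover have "cube d \<noteq> {}" by (auto simp: cube_def)
  then have "hard_class d x b k \<noteq> {}" by (simp add: hard_class_def)
  ultimately show ?thesis by (simp add: littlestone_classes_def)
qed

text \<open>If \<open>b j\<close> holds for some \<open>j < k\<close>, the last such
  \<open>j\<close> makes \<open>level x b j\<close> equal to the target; otherwise the target is
  constantly false and lies in the cube.\<close>

lemma target_in_hard_class: "target x b k \<in> hard_class d x b k"
proof (induction k)
  case 0
  show ?case by (auto simp: target_def hard_class_def cube_def)
next
  case (Suc k)
  have "target x b (Suc k) = (if b k then level x b k else target x b k)"
    by (auto simp: target_def level_def less_Suc_eq)
  then show ?case using Suc by (simp add: hard_class_Suc)
qed

lemma target_eq:
  assumes "inj_on x {..<k}" "i < k"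
  shows "target x b k (x i) = b i"
  using assms by (auto simp: target_def dest: inj_onD)

text \<open>The strict comparison resolves ties in favour of earlier concepts, which keeps later
  levels secret. The recursion also supplies the oracles of all truncated classes, with which the
  full oracle is compared below.\<close>

primrec hard_oracle :: "nat \<Rightarrow> (nat \<Rightarrow> nat) \<Rightarrow> (nat \<Rightarrow> bool) \<Rightarrow> nat \<Rightarrow> nat sample \<Rightarrow> nat concept" where
  "hard_oracle d x b 0 S = arg_min_on (empirical_error S) (cube d)"
| "hard_oracle d x b (Suc k) S =
     (if empirical_error S (level x b k) < empirical_error S (hard_oracle d x b k S)
      then level x b k else hard_oracle d x b k S)"

lemma hard_oracle_minimizes:
  "hard_oracle d x b k S \<in> hard_class d x b k \<and>
   (\<forall>c\<in>hard_class d x b k. empirical_error S (hard_oracle d x b k S) \<le> empirical_error S c)"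
proof (induction k)
  case 0
  have "finite (cube d)" "cube d \<noteq> {}" by (auto simp: cube_def)
  then show ?case
    using arg_min_if_finite[of "cube d" "empirical_error S"] by (auto simp: hard_class_def not_less)
next
  case (Suc k)
  let ?e = "empirical_error S"
  show ?case
  proof (cases "?e (level x b k) < ?e (hard_oracle d x b k S)")
    case True
    then have "?e (level x b k) \<le> ?e c" if "c \<in> hard_class d x b k" for c
      using Suc that by (meson less_le_trans less_imp_le)
    with True show ?thesis by (simp add: hard_class_Suc)
  next
    case False
    then show ?thesis using Suc by (simp add: hard_class_Suc)
  qed
qed

lemma hard_oracle_in_erm_oracles: "hard_oracle d x b k \<in> erm_oracles UNIV (hard_class d x b k)"
  using hard_oracle_minimizes by (simp add: erm_oracles_def is_arg_min_linorder)

text \<open>\<open>level x b i\<close> reads \<open>b\<close> only below \<open>i\<close>, and the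
  top level is \<open>k - 1\<close>, so \<open>b (k - 1)\<close> does not enter. This off-by-one
  later makes the oracle used for a block independent of that block's own majority.\<close>

lemma hard_oracle_cong:
  assumes "\<And>j. j < k \<Longrightarrow> x j = x' j" "\<And>j. Suc j < k \<Longrightarrow> b j = b' j"
  shows "hard_oracle d x b k = hard_oracle d x' b' k"
proof -
  have lv: "level x b i = level x' b' i" if "i < k" for i
  proof -
    have "(\<exists>j<i. p = x j \<and> b j) \<longleftrightarrow> (\<exists>j<i. p = x' j \<and> b' j)" for p
    proof (rule ex_cong1, rule conj_cong[OF refl])
      fix j assume "j < i"
      with that show "(p = x j \<and> b j) = (p = x' j \<and> b' j)"
        using assms(1)[of j] assms(2)[of j] by simp
    qed
    then show ?thesis using assms(1)[OF that] by (simp add: level_def)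
  qed
  have "hard_oracle d x b i S = hard_oracle d x' b' i S" if "i \<le> k" for i S
    using that by (induction i) (simp_all add: lv)
  then show ?thesis by blast
qed

text \<open>On \<open>S\<close> each level \<open>m\<close> with \<open>k \<le> m\<close> errs
  exactly like \<open>target x b k\<close>, which already belongs to the class truncated at
  \<open>k\<close>. It is thus never strictly better, and the recursion never picks it.\<close>

lemma hard_oracle_hides:
  assumes "\<And>j. k \<le> j \<Longrightarrow> j < n \<Longrightarrow> x j \<notin> fst ` S" "k \<le> n"
  shows "hard_oracle d x b n S = hard_oracle d x b k S"
  using assms(2,1)
proof (induction n rule: dec_induct)
  case (step m)
  have "empirical_error S (level x b m) = empirical_error S (target x b k)"
    unfolding empirical_error_def
  proof (rule sum.cong[OF refl], clarify)
    fix p y assume "(p, y) \<in> S"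
    then have "p \<noteq> x j" if "k \<le> j" "j \<le> m" for j
      using step.prems[of j] that by force
    then have ne: "p \<noteq> x j" if "k \<le> j" "j \<le> m" for j
      using that by blast
    have "level x b m p \<longleftrightarrow> (\<exists>j<m. p = x j \<and> b j)"
      using ne[of m] step.hyps by (simp add: level_def)
    also have "\<dots> \<longleftrightarrow> target x b k p"
      unfolding target_def
    proof (rule ex_cong1)
      fix j
      show "(j < m \<and> p = x j \<and> b j) = (j < k \<and> p = x j \<and> b j)"
        using ne[of j] step.hyps by (cases "k \<le> j") auto
    qed
    finally have "level x b m p = target x b k p" .
    then show "of_bool (level x b m p \<noteq> y) = (of_bool (target x b k p \<noteq> y) :: nat)" by simp
  qed
  moreover have "empirical_error S (hard_oracle d x b k S) \<le> empirical_error S (target x b k)"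
    using hard_oracle_minimizes target_in_hard_class by blast
  ultimately show ?case using step by simp
qed simp

section \<open>Transcripts under different oracles\<close>

text \<open>Fixed-point induction over the possibly nonterminating loop, with the set
  \<open>R h\<close> of extensions of \<open>h\<close> by answered queries as invariant.\<close>

lemma query_phase_support:
  assumes "h' \<in> set_spmf (query_phase A orc h)"
  shows "\<exists>qs. h' = h @ map (\<lambda>S. Answer S (orc S)) qs \<and>
    (\<forall>S\<in>set qs. \<exists>g. Some S \<in> set_pmf (next_query A g))"
proof -
  define R where "R = (\<lambda>h. {h @ map (\<lambda>S. Answer S (orc S)) qs | qs.
    \<forall>S\<in>set qs. \<exists>g. Some S \<in> set_pmf (next_query A g)})"
  have "\<forall>h. set_spmf (query_phase A orc h) \<subseteq> R h"
  proof (induction rule: query_phase.fixp_induct)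
    case 1
    then show ?case by simp
  next
    case 2
    then show ?case by simp
  next
    case (3 f)
    have "set_spmf (f A orc (h @ [Answer S (orc S)])) \<subseteq> R h"
      if "Some S \<in> set_pmf (next_query A h)" for h S
    proof
      fix g assume "g \<in> set_spmf (f A orc (h @ [Answer S (orc S)]))"
      then have "g \<in> R (h @ [Answer S (orc S)])" using 3 by blast
      then obtain qs where qs: "g = h @ map (\<lambda>S. Answer S (orc S)) (S # qs)"
        "\<forall>S\<in>set qs. \<exists>g. Some S \<in> set_pmf (next_query A g)"
        unfolding R_def by auto
      with that have "\<forall>S\<in>set (S # qs). \<exists>g. Some S \<in> set_pmf (next_query A g)" by auto
      with qs(1) show "g \<in> R h" unfolding R_def by blast
    qed
    moreover have "h \<in> R h" for h
      unfolding R_def by (rule CollectI, rule exI[of _ "[]"]) simp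
    ultimately show ?case
      by (auto simp: set_bind_spmf simp del: bind_spmf_of_pmf split: option.splits) blast
  qed
  with assms show ?thesis unfolding R_def by blast
qed

lemma query_phase_prefix: "h' \<in> set_spmf (query_phase A orc h) \<Longrightarrow> prefix h h'"
  using query_phase_support by (metis prefixI)

text \<open>\<open>G\<close> typically describes queries on which two oracles agree; such a
  transcript cannot tell them apart.\<close>

definition unaffected :: "('x sample \<Rightarrow> bool) \<Rightarrow> 'x transcript \<Rightarrow> bool" where
  "unaffected G h \<longleftrightarrow> (\<forall>S c. Answer S c \<in> set h \<longrightarrow> G S)"

lemma unaffected_prefix: "unaffected G h' \<Longrightarrow> prefix h h' \<Longrightarrow> unaffected G h"
  unfolding unaffected_def using set_mono_prefix by blast

text \<open>A transcript records every answer received, so the probability of reaching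
  \<open>h'\<close> involves the oracle only at the queries listed in \<open>h'\<close>; every other
  branch leaves the prefixes of \<open>h'\<close> and contributes 0. The induction is on the part of
  \<open>h'\<close> still to be produced.\<close>

lemma spmf_query_phase_cong:
  assumes G: "\<And>S. G S \<Longrightarrow> orc S = orc' S" and "unaffected G h'"
  shows "spmf (query_phase A orc h) h' = spmf (query_phase A orc' h) h'"
proof (induction "Suc (length h') - length h" arbitrary: h rule: less_induct)
  case less
  let ?br = "\<lambda>ora q. case q of None \<Rightarrow> return_spmf h
        | Some S \<Rightarrow> query_phase A ora (h @ [Answer S (ora S)])"
  have "spmf (?br orc q) h' = spmf (?br orc' q) h'" for q
  proof (cases q)
    case (Some S)
    have zero: "spmf (query_phase A ora (h @ [Answer S (ora S)])) h' = 0"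
      if "\<not> prefix (h @ [Answer S (ora S)]) h'" for ora
      using that query_phase_prefix by (metis spmf_eq_0_set_spmf)
    show ?thesis
    proof (cases "G S")
      case True
      then have eq: "orc S = orc' S" by (rule G)
      show ?thesis
      proof (cases "prefix (h @ [Answer S (orc S)]) h'")
        case True
        then have "length h < length h'" by (auto simp: prefix_def)
        then show ?thesis using less[of "h @ [Answer S (orc S)]"] Some eq by simp
      qed (use zero[of orc] zero[of orc'] eq Some in simp)
    next
      case False
      then have "\<not> prefix (h @ [Answer S (ora S)]) h'" for ora
        using unaffected_prefix[OF assms(2), of "h @ [Answer S (ora S)]"]
        by (auto simp: unaffected_def)
      with zero Some show ?thesis by simp
    qed
  qed simp
  then show ?case
    by (subst (1 2) query_phase.simps) (simp add: spmf_bind del: bind_spmf_of_pmf)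
qed

section \<open>Games with the full transcript, including the queries that \<open>play\<close>
  forgets\<close>

primrec transcript :: "'x learner \<Rightarrow> ('x sample \<Rightarrow> 'x concept) \<Rightarrow> 'x transcript \<Rightarrow>
  ('x \<times> bool) list \<Rightarrow> 'x transcript spmf" where
  "transcript A orc h [] = return_spmf h"
| "transcript A orc h (z # zs) =
     bind_spmf (query_phase A orc (h @ [Instance (fst z)]))
       (\<lambda>h'. bind_spmf (spmf_of_pmf (predict A h'))
          (\<lambda>b. transcript A orc (h' @ [Prediction b, Label (snd z)]) zs))"

lemma transcript_prefix: "h' \<in> set_spmf (transcript A orc h zs) \<Longrightarrow> prefix h h'"
proof (induction zs arbitrary: h)
  case (Cons z zs)
  then obtain g b where "prefix (h @ [Instance (fst z)]) g"
    "h' \<in> set_spmf (transcript A orc (g @ [Prediction b, Label (snd z)]) zs)"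
    by (auto simp: set_bind_spmf simp del: bind_spmf_of_pmf dest: query_phase_prefix)
  with Cons.IH show ?case by (meson prefix_order.trans append_prefixD)
qed simp

lemma transcript_unaffected:
  assumes "\<And>g S. Some S \<in> set_pmf (next_query A g) \<Longrightarrow> G S"
  shows "unaffected G h \<Longrightarrow> h' \<in> set_spmf (transcript A orc h zs) \<Longrightarrow> unaffected G h'"
proof (induction zs arbitrary: h)
  case (Cons z zs)
  then obtain g b where g: "g \<in> set_spmf (query_phase A orc (h @ [Instance (fst z)]))"
    "h' \<in> set_spmf (transcript A orc (g @ [Prediction b, Label (snd z)]) zs)"
    by (auto simp: set_bind_spmf simp del: bind_spmf_of_pmf)
  have "unaffected G (g @ [Prediction b, Label (snd z)])"
    using query_phase_support[OF g(1)] Cons.prems(1) assms by (fastforce simp: unaffected_def)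
  then show ?case using Cons.IH g(2) by blast
qed simp

text \<open>The laws of the first query phase can differ only at histories \<open>g\<close> that are
  no prefix of \<open>h'\<close>, and from these \<open>h'\<close> is unreachable.\<close>

lemma spmf_transcript_cong:
  assumes G: "\<And>S. G S \<Longrightarrow> orc S = orc' S" and "unaffected G h'"
  shows "spmf (transcript A orc h zs) h' = spmf (transcript A orc' h zs) h'"
proof (induction zs arbitrary: h)
  case (Cons z zs)
  let ?h = "h @ [Instance (fst z)]"
  let ?rest = "\<lambda>ora g. bind_spmf (spmf_of_pmf (predict A g))
          (\<lambda>b. transcript A ora (g @ [Prediction b, Label (snd z)]) zs)"
  have rest: "spmf (?rest orc g) h' = spmf (?rest orc' g) h'" for g
    by (simp add: spmf_bind Cons.IH del: bind_spmf_of_pmf)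
  have zero: "spmf (?rest ora g) h' = 0" if "\<not> prefix g h'" for ora g
  proof -
    have "h' \<notin> set_spmf (?rest ora g)"
      using that transcript_prefix append_prefixD by (fastforce simp: set_bind_spmf simp del: bind_spmf_of_pmf)
    then show ?thesis by (simp add: spmf_eq_0_set_spmf)
  qed
  have "spmf (query_phase A orc ?h) g * spmf (?rest orc g) h' =
        spmf (query_phase A orc' ?h) g * spmf (?rest orc' g) h'" for g
  proof (cases "prefix g h'")
    case True
    then have "unaffected G g" using assms(2) unaffected_prefix by blast
    then show ?thesis using spmf_query_phase_cong[of G orc orc' g, OF G] rest by simp
  qed (simp add: zero del: bind_spmf_of_pmf)
  moreover have "ennreal (spmf (transcript A ora h (z # zs)) h') =
      (\<integral>\<^sup>+ g. ennreal (spmf (query_phase A ora ?h) g * spmf (?rest ora g) h') \<partial>count_space UNIV)" for ora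
    unfolding transcript.simps
    by (subst ennreal_spmf_bind) (simp only: nn_integral_measure_spmf ennreal_mult pmf_nonneg)
  ultimately have "ennreal (spmf (transcript A orc h (z # zs)) h') =
      ennreal (spmf (transcript A orc' h (z # zs)) h')"
    by presburger
  then show ?case by simp
qed simp

section \<open>Passing from transcripts to predictions\<close>

fun predictions :: "'x transcript \<Rightarrow> bool list" where
  "predictions [] = []"
| "predictions (Prediction b # h) = b # predictions h"
| "predictions (_ # h) = predictions h"

lemma predictions_append [simp]: "predictions (g @ h) = predictions g @ predictions h"
  by (induction g rule: predictions.induct) auto

lemma predictions_answers [simp]: "predictions (map (\<lambda>S. Answer S (orc S)) qs) = []"
  by (induction qs) auto

lemma predictions_transcript:
  "map_spmf predictions (transcript A orc h zs) = map_spmf ((@) (predictions h)) (play A orc h zs)"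
proof (induction zs arbitrary: h)
  case (Cons z zs)
  have "map_spmf predictions (transcript A orc h (z # zs)) =
    bind_spmf (query_phase A orc (h @ [Instance (fst z)]))
       (\<lambda>g. bind_spmf (spmf_of_pmf (predict A g))
          (\<lambda>b. map_spmf (\<lambda>bs. predictions g @ b # bs) (play A orc (g @ [Prediction b, Label (snd z)]) zs)))"
    by (simp add: map_spmf_bind_spmf o_def Cons.IH del: bind_spmf_of_pmf)
  also have "\<dots> = bind_spmf (query_phase A orc (h @ [Instance (fst z)]))
       (\<lambda>g. bind_spmf (spmf_of_pmf (predict A g))
          (\<lambda>b. map_spmf (\<lambda>bs. predictions h @ b # bs) (play A orc (g @ [Prediction b, Label (snd z)]) zs)))"
    by (rule bind_spmf_cong) (auto dest: query_phase_support)
  also have "\<dots> = map_spmf ((@) (predictions h)) (play A orc h (z # zs))"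
    by (simp add: map_spmf_bind_spmf spmf.map_comp o_def del: bind_spmf_of_pmf)
  finally show ?case .
qed (simp add: map_spmf_conv_bind_spmf)

lemma play_conv_transcript: "play A orc [] zs = map_spmf predictions (transcript A orc [] zs)"
proof -
  have "(@) [] = (id :: bool list \<Rightarrow> bool list)" by auto
  then show ?thesis by (simp add: predictions_transcript spmf.map_id)
qed

text \<open>Rounds after the \<open>k\<close>-th might keep querying forever and lose mass, which
  would make the left side smaller. Losslessness of the whole game passes to every reachable
  continuation and excludes this.\<close>

lemma play_take:
  assumes "lossless_spmf (play A orc h zs)"
  shows "map_spmf (take k) (play A orc h zs) = play A orc h (take k zs)"
  using assms
proof (induction zs arbitrary: h k)
  case Nil
  then show ?case by simp
next
  case (Cons z zs)
  show ?case
  proof (cases k)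
    case 0
    have "map_spmf (take k) (play A orc h (z # zs)) = map_spmf (\<lambda>_. []) (play A orc h (z # zs))"
      using 0 by (simp del: play.simps)
    also have "\<dots> = return_spmf []"
      using Cons.prems by (simp add: map_spmf_conv_bind_spmf bind_spmf_const lossless_weight_spmfD del: play.simps)
    finally show ?thesis using 0 by simp
  next
    case (Suc j)
    have "map_spmf (\<lambda>bs. b # take j bs) (play A orc (g @ [Prediction b, Label (snd z)]) zs)
        = map_spmf ((#) b) (play A orc (g @ [Prediction b, Label (snd z)]) (take j zs))"
      if "g \<in> set_spmf (query_phase A orc (h @ [Instance (fst z)]))" "b \<in> set_pmf (predict A g)" for g b
    proof -
      have "lossless_spmf (play A orc (g @ [Prediction b, Label (snd z)]) zs)"
        using Cons.prems that by (auto simp del: bind_spmf_of_pmf)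
      from Cons.IH[OF this, of j, symmetric] show ?thesis by (simp add: spmf.map_comp o_def)
    qed
    then show ?thesis unfolding Suc
      by (auto simp: map_spmf_bind_spmf spmf.map_comp o_def simp del: bind_spmf_of_pmf intro!: bind_spmf_cong)
  qed
qed

text \<open>The last label is revealed only after the last prediction has been drawn.\<close>

lemma play_last_label:
  "play A orc h (zs @ [(x, y)]) = play A orc h (zs @ [(x, y')])"
  by (induction zs arbitrary: h) auto

text \<open>A transcript holds finitely many queries, each a finite sample, so it touches finitely
  many points and the indicator of touching \<open>v\<close> tends to 0 pointwise. Dominated
  convergence turns this into small probability, with no bound on the number of queries.\<close>

lemma eventually_untouched:
  fixes A :: "nat learner"
  assumes "admissible_learner X A" "0 < e"
  shows "\<forall>\<^sub>F v in sequentially.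
    measure (measure_spmf (transcript A orc [] zs)) {h. \<not> unaffected (\<lambda>S. v \<notin> fst ` S) h} \<le> e"
proof -
  let ?M = "measure_spmf (transcript A orc [] zs)"
  let ?B = "\<lambda>v. {h. \<not> unaffected (\<lambda>S. v \<notin> fst ` S) h}"
  have "(\<lambda>v. indicat_real (?B v) h) \<longlonglongrightarrow> 0" if "h \<in> set_spmf (transcript A orc [] zs)" for h
  proof -
    have fin: "unaffected finite h"
    proof (rule transcript_unaffected)
      show "unaffected finite ([] :: nat transcript)" by (simp add: unaffected_def)
      show "h \<in> set_spmf (transcript A orc [] zs)" by (rule that)
      show "finite S" if "Some S \<in> set_pmf (next_query A g)" for g S
        using assms(1) that by (simp add: admissible_learner_def)
    qed
    define V where "V = (\<Union>e\<in>set h. case e of Answer S c \<Rightarrow> fst ` S | _ \<Rightarrow> {})"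
    have "finite V"
      unfolding V_def
    proof (rule finite_UN_I[OF finite_set])
      show "finite (case e of Answer S c \<Rightarrow> fst ` S | _ \<Rightarrow> {})" if "e \<in> set h" for e
        using fin that by (cases e) (auto simp: unaffected_def)
    qed
    then obtain N where N: "\<forall>v\<in>V. v < N"
      unfolding finite_nat_set_iff_bounded ..
    have "h \<notin> ?B v" if "v \<ge> N" for v
    proof
      assume "h \<in> ?B v"
      then obtain S c where "Answer S c \<in> set h" "v \<in> fst ` S" by (auto simp: unaffected_def)
      then have "v \<in> V" unfolding V_def by (intro UN_I[of "Answer S c"]) simp_all
      with N that show False by (metis leD)
    qed
    then have "\<forall>\<^sub>F v in sequentially. indicat_real (?B v) h = 0"
      unfolding eventually_sequentially by (intro exI[of _ N] allI impI indicator_simps)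
    then show ?thesis by (rule tendsto_eventually)
  qed
  then have "(\<lambda>v. \<integral>h. indicat_real (?B v) h \<partial>?M) \<longlonglongrightarrow> (\<integral>h. 0 \<partial>?M)"
    by (intro integral_dominated_convergence[where w = "\<lambda>_. 1"]) (simp_all add: indicator_def)
  then have "(\<lambda>v. measure ?M (?B v)) \<longlonglongrightarrow> 0" by simp
  from order_tendstoD(2)[OF this assms(2)] show ?thesis
    by (rule eventually_mono) simp
qed

text \<open>Both oracles give the same mass to every unaffected transcript, so only affected ones
  can lower the probability of \<open>E\<close>. Their mass is measured under \<open>orc'\<close>
  alone; this will be the truncated oracle, for which it is small.\<close>

lemma play_perturb:
  assumes "\<And>S. G S \<Longrightarrow> orc S = orc' S"
  shows "measure (measure_spmf (play A orc' [] zs)) E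
     - measure (measure_spmf (transcript A orc' [] zs)) {h. \<not> unaffected G h}
     \<le> measure (measure_spmf (play A orc [] zs)) E"
proof -
  let ?M = "\<lambda>ora. measure_spmf (transcript A ora [] zs)"
  let ?E = "predictions -` E" and ?U = "{h. unaffected G h}"
  have "(transcript A orc [] zs) \<upharpoonleft> ?U = (transcript A orc' [] zs) \<upharpoonleft> ?U"
    by (rule spmf_eqI) (simp add: spmf_restrict_spmf spmf_transcript_cong[of G orc orc'] assms)
  then have eq: "measure (?M orc) (?E \<inter> ?U) = measure (?M orc') (?E \<inter> ?U)"
    unfolding measure_restrict_spmf[symmetric] by (rule arg_cong)
  have "measure (?M orc') ?E \<le> measure (?M orc') (?E \<inter> ?U \<union> {h. \<not> unaffected G h})"
    by (intro measure_spmf.finite_measure_mono) auto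
  also have "\<dots> \<le> measure (?M orc') (?E \<inter> ?U) + measure (?M orc') {h. \<not> unaffected G h}"
    by (intro measure_Un_le) auto
  also have "measure (?M orc') (?E \<inter> ?U) \<le> measure (?M orc) ?E"
    unfolding eq[symmetric] by (intro measure_spmf.finite_measure_mono) auto
  finally show ?thesis by (simp add: play_conv_transcript measure_map_spmf)
qed

section \<open>Moments of random signs\<close>

definition flip :: "nat \<Rightarrow> bool list \<Rightarrow> bool list" where
  "flip t ys = ys[t := \<not> ys ! t]"

lemma sum_flip_odd:
  fixes f :: "bool list \<Rightarrow> real"
  assumes "t < T" "\<And>ys. length ys = T \<Longrightarrow> f (flip t ys) = - f ys"
  shows "(\<Sum>ys | length ys = T. f ys) = 0"
proof -
  have "(\<Sum>ys | length ys = T. f ys) = (\<Sum>ys | length ys = T. f (flip t ys))"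
    by (rule sum.reindex_bij_witness[of _ "flip t" "flip t"]) (use assms(1) in \<open>auto simp: flip_def\<close>)
  also have "\<dots> = - (\<Sum>ys | length ys = T. f ys)"
    by (simp add: assms(2) sum_negf)
  finally show ?thesis by simp
qed

definition sign_sum :: "nat set \<Rightarrow> bool list \<Rightarrow> real" where
  "sign_sum J ys = (\<Sum>t\<in>J. if ys ! t then 1 else -1)"

lemma sign_sum_flip:
  assumes "t \<notin> J" "t < length ys"
  shows "sign_sum J (flip t ys) = sign_sum J ys"
  unfolding sign_sum_def by (rule sum.cong) (use assms in \<open>auto simp: flip_def nth_list_update\<close>)

lemma finite_label_lists [simp]: "finite {ys :: bool list. length ys = T}"
  using finite_lists_length_eq[of "UNIV :: bool set" T] by simp

lemma card_label_lists: "card {ys :: bool list. length ys = T} = 2 ^ T"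
  using card_lists_length_eq[of "UNIV :: bool set" T] by simp

text \<open>Signs are added one at a time. Terms with an odd power of the new sign cancel by
  \<open>sum_flip_odd\<close>, so on average the second moment grows by 1 and the fourth by 1 plus
  six times the second.\<close>

lemma sign_sum_moments:
  assumes "finite J" "J \<subseteq> {..<T}"
  shows "(\<Sum>ys | length ys = T. sign_sum J ys ^ 2) = 2 ^ T * real (card J)"
    and "(\<Sum>ys | length ys = T. sign_sum J ys ^ 4) \<le> 2 ^ T * (3 * real (card J) ^ 2)"
proof -
  have "(\<Sum>ys | length ys = T. sign_sum J ys ^ 2) = 2 ^ T * real (card J) \<and>
    (\<Sum>ys | length ys = T. sign_sum J ys ^ 4) \<le> 2 ^ T * (3 * real (card J) ^ 2)"
    using assms
  proof (induction J)
    case empty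
    then show ?case by (simp add: sign_sum_def)
  next
    case (insert t J)
    let ?L = "{ys. length ys = T}"
    let ?s = "\<lambda>ys. if ys ! t then 1 else -1 :: real"
    have t: "t < T" using insert by auto
    have sq: "?s ys ^ 2 = 1" "?s ys ^ 3 = ?s ys" "?s ys ^ 4 = 1" for ys by auto
    have S: "sign_sum (insert t J) ys = ?s ys + sign_sum J ys" for ys
      using insert by (simp add: sign_sum_def)
    have odd: "(\<Sum>ys\<in>?L. ?s ys * g (sign_sum J ys)) = 0" for g
    proof (rule sum_flip_odd[OF t])
      fix ys :: "bool list" assume "length ys = T"
      then have nth: "flip t ys ! t = (\<not> ys ! t)" using t by (simp add: flip_def)
      have eq: "sign_sum J (flip t ys) = sign_sum J ys"
        by (rule sign_sum_flip) (use t insert.hyps \<open>length ys = T\<close> in simp_all)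
      show "?s (flip t ys) * g (sign_sum J (flip t ys)) = - (?s ys * g (sign_sum J ys))"
        unfolding nth eq by simp
    qed
    have p2: "sign_sum (insert t J) ys ^ 2 = 1 + 2 * (?s ys * sign_sum J ys) + sign_sum J ys ^ 2" for ys
      unfolding S power2_sum sq by simp
    have p4: "sign_sum (insert t J) ys ^ 4 =
      1 + 4 * (?s ys * sign_sum J ys) + 6 * sign_sum J ys ^ 2 + 4 * (?s ys * sign_sum J ys ^ 3)
        + sign_sum J ys ^ 4" for ys
    proof -
      have power4_sum: "(a + b) ^ 4 = a ^ 4 + 4 * (a ^ 3 * b) + 6 * (a ^ 2 * b ^ 2) + 4 * (a * b ^ 3) + b ^ 4"
        for a b :: real by (simp add: eval_nat_numeral algebra_simps)
      show ?thesis unfolding S power4_sum sq by simp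
    qed
    have "(\<Sum>ys\<in>?L. sign_sum (insert t J) ys ^ 2) = 2 ^ T + (\<Sum>ys\<in>?L. sign_sum J ys ^ 2)"
      unfolding p2 sum.distrib sum_distrib_left[symmetric] using odd[of "\<lambda>v. v"]
      by (simp add: card_label_lists)
    moreover have "(\<Sum>ys\<in>?L. sign_sum (insert t J) ys ^ 4) =
        2 ^ T + 6 * (\<Sum>ys\<in>?L. sign_sum J ys ^ 2) + (\<Sum>ys\<in>?L. sign_sum J ys ^ 4)"
      unfolding p4 sum.distrib sum_distrib_left[symmetric] using odd[of "\<lambda>v. v"] odd[of "\<lambda>v. v ^ 3"]
      by (simp add: card_label_lists)
    \<comment> \<open>With \<open>k = card J\<close>, the recurrence needs
      \<open>3 * k ^ 2 + 6 * k + 1 \<le> 3 * (k + 1) ^ 2\<close>, which holds with slack 2.\<close>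
    moreover have "2 ^ T * (3 * real (Suc (card J)) ^ 2)
        = 3 * 2 ^ T + 6 * (2 ^ T * real (card J)) + 2 ^ T * (3 * real (card J) ^ 2)"
      by (simp add: algebra_simps power2_eq_square)
    moreover have "2 ^ T * real (Suc (card J)) = 2 ^ T + 2 ^ T * real (card J)"
      by (simp add: algebra_simps)
    moreover have "(0 :: real) \<le> 2 ^ T" by simp
    moreover have card: "card (insert t J) = Suc (card J)" using insert.hyps by simp
    moreover have "(\<Sum>ys\<in>?L. sign_sum J ys ^ 2) = 2 ^ T * real (card J)"
      "(\<Sum>ys\<in>?L. sign_sum J ys ^ 4) \<le> 2 ^ T * (3 * real (card J) ^ 2)"
      using insert.IH insert.prems by simp_all
    ultimately show ?case unfolding card by (intro conjI) linarith+
  qed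
  then show "(\<Sum>ys | length ys = T. sign_sum J ys ^ 2) = 2 ^ T * real (card J)"
    "(\<Sum>ys | length ys = T. sign_sum J ys ^ 4) \<le> 2 ^ T * (3 * real (card J) ^ 2)" by auto
qed

text \<open>
  The moments enter through \<open>v \<ge> v ^ 2 - 4 / 27 * v ^ 4\<close> for \<open>v = \<bar>sign_sum J ys\<bar> / sqrt (card J)\<close>;
  the constant 4/27 makes this tight at \<open>v = 3 / 2\<close>.
\<close>

lemma khintchine:
  assumes "J \<subseteq> {..<T}"
  shows "5 / 9 * sqrt (card J) * 2 ^ T \<le> (\<Sum>ys | length ys = T. \<bar>sign_sum J ys\<bar>)"
proof (cases "card J = 0")
  case True
  then show ?thesis by (simp add: sum_nonneg)
next
  case False
  have fin: "finite J" using assms finite_subset by blast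
  define r where "r = sqrt (card J)"
  have r: "r > 0" "r ^ 2 = card J" using False by (auto simp: r_def)
  have ineq: "v ^ 2 - 4 / 27 * v ^ 4 \<le> v" if "v \<ge> 0" for v :: real
  proof -
    have "v - (v ^ 2 - 4 / 27 * v ^ 4) = 4 / 27 * v * (v - 3 / 2) ^ 2 * (v + 3)"
      by (simp add: field_simps power2_eq_square power4_eq_xxxx)
    also have "\<dots> \<ge> 0" using that by simp
    finally show ?thesis by simp
  qed
  have "sign_sum J ys ^ 2 / r - 4 / 27 * (sign_sum J ys ^ 4 / r ^ 3) \<le> \<bar>sign_sum J ys\<bar>" for ys
  proof -
    have "r * ((\<bar>sign_sum J ys\<bar> / r) ^ 2 - 4 / 27 * (\<bar>sign_sum J ys\<bar> / r) ^ 4) \<le> r * (\<bar>sign_sum J ys\<bar> / r)"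
      using r by (intro mult_left_mono ineq) auto
    moreover have "r * ((\<bar>sign_sum J ys\<bar> / r) ^ 2 - 4 / 27 * (\<bar>sign_sum J ys\<bar> / r) ^ 4)
        = sign_sum J ys ^ 2 / r - 4 / 27 * (sign_sum J ys ^ 4 / r ^ 3)"
    proof -
      have "r * (u ^ 2 / r ^ 2) = u ^ 2 / r" "r * (u ^ 4 / r ^ 4) = u ^ 4 / r ^ 3" for u
        using r(1) by (simp_all add: power2_eq_square[of r] power3_eq_cube[of r] power4_eq_xxxx[of r])
      then show ?thesis
        by (simp only: power_divide right_diff_distrib power_even_abs_numeral even_numeral
            mult.left_commute[of r])
    qed
    moreover have "r * (\<bar>sign_sum J ys\<bar> / r) = \<bar>sign_sum J ys\<bar>" using r(1) by simp
    ultimately show ?thesis by simp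
  qed
  then have "(\<Sum>ys | length ys = T. sign_sum J ys ^ 2 / r - 4 / 27 * (sign_sum J ys ^ 4 / r ^ 3))
      \<le> (\<Sum>ys | length ys = T. \<bar>sign_sum J ys\<bar>)"
    by (rule sum_mono)
  moreover have "(\<Sum>ys | length ys = T. sign_sum J ys ^ 2 / r - 4 / 27 * (sign_sum J ys ^ 4 / r ^ 3))
     = 2 ^ T * real (card J) / r - 4 / 27 * ((\<Sum>ys | length ys = T. sign_sum J ys ^ 4) / r ^ 3)"
    by (simp only: sum_subtractf sum_distrib_left[symmetric] sum_divide_distrib[symmetric]
        sign_sum_moments(1)[OF fin assms])
  moreover have "(\<Sum>ys | length ys = T. sign_sum J ys ^ 4) / r ^ 3 \<le> 2 ^ T * (3 * (r ^ 2) ^ 2) / r ^ 3"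
    using sign_sum_moments(2)[OF fin assms] r by (intro divide_right_mono) auto
  moreover have "2 ^ T * (3 * (r ^ 2) ^ 2) / r ^ 3 = 3 * r * 2 ^ T"
    using r(1) by (simp add: field_simps eval_nat_numeral)
  moreover have "2 ^ T * real (card J) / r = r * 2 ^ T"
    using r by (simp add: power2_eq_square flip: r(2))
  \<comment> \<open>The second moment contributes \<open>r * 2 ^ T\<close>, and the fourth takes
    away at most the fraction 4/27 * 3 = 4/9 of it, which leaves 5/9.\<close>
  ultimately show ?thesis unfolding r_def[symmetric] by linarith
qed

section \<open>Regret against random labels in blocks\<close>

text \<open>The infimum in \<open>regret\<close> is at most the error of any \<open>c\<close> in
  \<open>C\<close>; the rest is linearity of expectation. Losslessness lets the constant infimum
  integrate to itself.\<close>

lemma expected_regret_ge: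
  assumes lossless: "lossless_spmf (play A orc [] zs)" and "c \<in> C"
  shows "(\<Sum>t<length zs. measure (measure_spmf (play A orc [] zs)) {bs. bs ! t \<noteq> snd (zs ! t)})
     - (\<Sum>t<length zs. of_bool (c (fst (zs ! t)) \<noteq> snd (zs ! t))) \<le> expected_regret A C orc zs"
proof -
  let ?M = "measure_spmf (play A orc [] zs)"
  let ?err = "\<lambda>c. \<Sum>t<length zs. of_bool (c (fst (zs ! t)) \<noteq> snd (zs ! t)) :: real"
  have "(INF c\<in>C. ?err c) \<le> ?err c"
    by (rule cINF_lower[OF _ assms(2)], rule bdd_belowI2[of _ 0]) (simp add: sum_nonneg)
  moreover have "expected_regret A C orc zs =
    (\<Sum>t<length zs. measure ?M {bs. bs ! t \<noteq> snd (zs ! t)}) - (INF c\<in>C. ?err c)"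
  proof -
    have int: "integrable ?M (\<lambda>bs. indicat_real {bs. bs ! t \<noteq> snd (zs ! t)} bs)" for t
      by (rule measure_spmf.integrable_const_bound[of _ 1]) (simp_all add: indicator_def)
    have "expected_regret A C orc zs = (LINT bs|?M.
        (\<Sum>t<length zs. indicat_real {bs. bs ! t \<noteq> snd (zs ! t)} bs) - (INF c\<in>C. ?err c))"
      unfolding expected_regret_def regret_def
      by (intro Bochner_Integration.integral_cong refl) (simp add: indicator_def of_bool_def)
    also have "\<dots> = (LINT bs|?M. (\<Sum>t<length zs. indicat_real {bs. bs ! t \<noteq> snd (zs ! t)} bs))
        - (LINT bs|?M. (INF c\<in>C. ?err c))"
      by (intro Bochner_Integration.integral_diff Bochner_Integration.integrable_sum int)
        (rule measure_spmf.integrable_const)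
    also have "(LINT bs|?M. (\<Sum>t<length zs. indicat_real {bs. bs ! t \<noteq> snd (zs ! t)} bs))
        = (\<Sum>t<length zs. measure ?M {bs. bs ! t \<noteq> snd (zs ! t)})"
      by (subst Bochner_Integration.integral_sum[OF int]) simp
    also have "(LINT bs|?M. (INF c\<in>C. ?err c)) = (INF c\<in>C. ?err c)"
      using lossless by (simp add: lossless_spmf_def weight_spmf_def)
    finally show ?thesis .
  qed
  ultimately show ?thesis by simp
qed

section \<open>The game whose points are presented in blocks\<close>

locale blocked_game =
  fixes A :: "nat learner" and d n T :: nat and blk :: "nat \<Rightarrow> nat"
  assumes admissible: "admissible_learner UNIV A"
    and finite_queries: "finitely_many_queries UNIV (littlestone_classes UNIV d) T A"
    and n_less: "n < 2 ^ d"
    and mono_blk: "mono blk"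
    and blk_less: "blk t < n"
begin

definition rounds :: "(nat \<Rightarrow> nat) \<Rightarrow> bool list \<Rightarrow> (nat \<times> bool) list" where
  "rounds x ys = map (\<lambda>t. (x (blk t), ys ! t)) [0..<T]"

definition block :: "nat \<Rightarrow> nat set" where
  "block i = {t. t < T \<and> blk t = i}"

definition majority :: "bool list \<Rightarrow> nat \<Rightarrow> bool" where
  "majority ys i \<longleftrightarrow> 0 \<le> sign_sum (block i) ys"

abbreviation oracle_up_to :: "(nat \<Rightarrow> nat) \<Rightarrow> bool list \<Rightarrow> nat \<Rightarrow> nat sample \<Rightarrow> nat concept" where
  "oracle_up_to x ys k \<equiv> hard_oracle d x (majority ys) k"

text \<open>The game stops after round \<open>t\<close>, and the class is truncated after the level
  of the current block. In this form the law involves only \<open>x i\<close> with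
  \<open>i \<le> blk t\<close>, so later points can be chosen in view of it.\<close>

definition round_law :: "(nat \<Rightarrow> nat) \<Rightarrow> bool list \<Rightarrow> nat \<Rightarrow> nat transcript spmf" where
  "round_law x ys t =
     transcript A (oracle_up_to x ys (Suc (blk t))) [] (take (Suc t) (rounds x ys))"

lemma length_rounds [simp]: "length (rounds x ys) = T"
  by (simp add: rounds_def)

lemma round_nth [simp]: "t < T \<Longrightarrow> rounds x ys ! t = (x (blk t), ys ! t)"
  by (simp add: rounds_def)

text \<open>Truncated classes have Littlestone dimension \<open>d\<close> too, so the assumption on
  the learner's queries also covers the truncated oracles.\<close>

lemma lossless_play:
  assumes "k \<le> n"
  shows "lossless_spmf (play A (hard_oracle d x b k) [] (rounds x' ys))"
proof -
  have "hard_class d x b k \<in> littlestone_classes UNIV d"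
    using assms n_less by (intro hard_class_in_littlestone_classes) simp
  moreover have "rounds x' ys \<in> sequences UNIV T" by (simp add: sequences_def)
  ultimately show ?thesis
    using finite_queries hard_oracle_in_erm_oracles unfolding finitely_many_queries_def by metis
qed

lemma finite_block [simp]: "finite (block i)"
  by (simp add: block_def)

lemma round_law_cong:
  assumes "t < T" "\<And>i. i \<le> blk t \<Longrightarrow> x i = x' i"
  shows "round_law x ys t = round_law x' ys t"
proof -
  have "take (Suc t) (rounds x ys) = take (Suc t) (rounds x' ys)"
  proof (rule nth_equalityI)
    fix s assume "s < length (take (Suc t) (rounds x ys))"
    then have s: "s \<le> t" "s < T" by auto
    then have "x (blk s) = x' (blk s)" using assms(2) monoD[OF mono_blk] by simp
    then show "take (Suc t) (rounds x ys) ! s = take (Suc t) (rounds x' ys) ! s" using s by simp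
  qed simp
  moreover have "oracle_up_to x ys (Suc (blk t)) = oracle_up_to x' ys (Suc (blk t))"
    by (rule hard_oracle_cong) (simp_all add: assms(2))
  ultimately show ?thesis by (simp add: round_law_def)
qed

text \<open>The points are chosen one after the other. The laws of rounds in blocks before
  \<open>j\<close> depend only on points before \<open>j\<close>, and there are finitely many of
  them over all \<open>t\<close> and \<open>ys\<close>, so by \<open>eventually_untouched\<close>
  every sufficiently large value is suitable for \<open>x j\<close>. Treating all \<open>ys\<close>
  at once keeps \<open>x\<close> independent of the labels, which permits averaging over
  them.\<close>

lemma hidden_points:
  fixes e :: real
  assumes "0 < e"
  obtains x where "inj x"
    "\<And>j t ys. \<lbrakk>t < T; blk t < j; length ys = T\<rbrakk> \<Longrightarrow>
      measure (measure_spmf (round_law x ys t)) {h. \<not> unaffected (\<lambda>S. x j \<notin> fst ` S) h} \<le> e"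
proof -
  let ?hid = "\<lambda>x t ys v.
    measure (measure_spmf (round_law x ys t)) {h. \<not> unaffected (\<lambda>S. v \<notin> fst ` S) h} \<le> e"
  define P where "P = (\<lambda>x j v. v \<notin> x ` {..<j} \<and>
    (\<forall>t\<in>{t. t < T \<and> blk t < j}. \<forall>ys\<in>{ys. length ys = T}. ?hid x t ys v))"
  have "\<exists>x. \<forall>j. P x j (x j)"
  proof (rule dependent_wellorder_choice)
    \<comment> \<open>The choice principle demands that the condition at \<open>j\<close> looks at
      \<open>x\<close> only below \<open>j\<close>.\<close>
    fix v :: nat and x x' :: "nat \<Rightarrow> nat" and j :: nat
    assume eq: "\<And>i. i < j \<Longrightarrow> x i = x' i"
    have "round_law x ys t = round_law x' ys t" if "t < T" "blk t < j" for t ys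
      using that eq by (intro round_law_cong) simp_all
    moreover have "x ` {..<j} = x' ` {..<j}" using eq by (intro image_cong) simp_all
    ultimately show "P x j v = P x' j v" unfolding P_def by simp
  next
    fix x :: "nat \<Rightarrow> nat" and j :: nat
    have "finite {t. t < T \<and> blk t < j}" by simp
    moreover have "\<forall>\<^sub>F v in sequentially. ?hid x t ys v" for t ys
      unfolding round_law_def by (rule eventually_untouched[OF admissible assms])
    ultimately have "\<forall>\<^sub>F v in sequentially.
        \<forall>t\<in>{t. t < T \<and> blk t < j}. \<forall>ys\<in>{ys. length ys = T}. ?hid x t ys v"
      by (intro eventually_ball_finite ballI) simp_all
    moreover have "\<forall>\<^sub>F v in sequentially. v \<notin> x ` {..<j}"
    proof -
      have "finite (x ` {..<j})" by simp
      then obtain N where "\<forall>v\<in>x ` {..<j}. v < N" unfolding finite_nat_set_iff_bounded ..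
      then show ?thesis unfolding eventually_sequentially by (metis leD)
    qed
    ultimately have "\<forall>\<^sub>F v in sequentially. P x j v"
      unfolding P_def by (rule eventually_conj[rotated])
    then show "\<exists>v. P x j v" by (rule eventually_happens'[rotated]) simp
  qed
  then obtain x where x: "\<And>j. P x j (x j)" by metis
  have "inj x"
  proof (rule linorder_injI)
    fix i j :: nat assume "i < j"
    then show "x i \<noteq> x j" using x[of j] unfolding P_def by (metis imageI lessThan_iff)
  qed
  with x that show ?thesis unfolding P_def by simp
qed

lemma majority_flip:
  assumes "t < T" "length ys = T" "i \<noteq> blk t"
  shows "majority (flip t ys) i = majority ys i"
  using assms sign_sum_flip[of t "block i" ys] by (simp add: majority_def block_def)

text \<open>
  The loss in round \<open>t\<close> against the oracle of the truncated class; that oracle depends on the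
  labels only through the majorities of the blocks before that of \<open>t\<close>.
\<close>

definition hidden_loss :: "(nat \<Rightarrow> nat) \<Rightarrow> nat \<Rightarrow> bool list \<Rightarrow> real" where
  "hidden_loss x t ys = measure
     (measure_spmf (play A (oracle_up_to x ys (Suc (blk t))) [] (take (Suc t) (rounds x ys))))
     {bs. bs ! t \<noteq> ys ! t}"

text \<open>The prediction of round \<open>t\<close> is drawn before label \<open>t\<close> is
  shown, and the truncated oracle uses only majorities of earlier blocks. Flipping label
  \<open>t\<close> thus leaves the play unchanged and exchanges errors with correct
  predictions.\<close>

lemma hidden_loss_flip:
  assumes "t < T" "length ys = T"
  shows "hidden_loss x t (flip t ys) = 1 - hidden_loss x t ys"
proof -
  let ?p = "\<lambda>ys. play A (oracle_up_to x ys (Suc (blk t))) [] (take (Suc t) (rounds x ys))"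
  have orc: "oracle_up_to x (flip t ys) (Suc (blk t)) = oracle_up_to x ys (Suc (blk t))"
    by (rule hard_oracle_cong) (simp_all add: majority_flip assms)
  have take: "take t (rounds x (flip t ys)) = take t (rounds x ys)"
    by (rule nth_equalityI) (simp_all add: flip_def)
  have snoc: "take (Suc t) (rounds x zs) = take t (rounds x zs) @ [(x (blk t), zs ! t)]" for zs
    using assms(1) by (simp add: take_Suc_conv_app_nth)
  have same: "?p (flip t ys) = ?p ys"
    unfolding orc snoc take by (rule play_last_label)
  have "lossless_spmf (?p ys)"
    using lossless_play[of "Suc (blk t)"] blk_less[of t]
    by (metis play_take lossless_map_spmf Suc_leI)
  then have weight: "weight_spmf (?p ys) = 1"
    by (simp add: lossless_spmf_def)
  have "{bs. bs ! t \<noteq> flip t ys ! t} = space (measure_spmf (?p ys)) - {bs. bs ! t \<noteq> ys ! t}"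
    using assms by (auto simp: flip_def space_measure_spmf)
  then have "measure (measure_spmf (?p ys)) {bs. bs ! t \<noteq> flip t ys ! t}
      = 1 - measure (measure_spmf (?p ys)) {bs. bs ! t \<noteq> ys ! t}"
    using measure_spmf.finite_measure_compl[of "{bs. bs ! t \<noteq> ys ! t}" "?p ys"] weight by simp
  then show ?thesis unfolding hidden_loss_def same .
qed

text \<open>The deviation of the loss from 1/2 is odd under \<open>flip t\<close>.\<close>

lemma sum_hidden_loss:
  assumes "t < T"
  shows "(\<Sum>ys | length ys = T. hidden_loss x t ys) = 2 ^ T / 2"
proof -
  have "(\<Sum>ys | length ys = T. hidden_loss x t ys - 1 / 2) = 0"
    by (rule sum_flip_odd[OF assms]) (simp add: hidden_loss_flip assms)
  then show ?thesis by (simp add: sum_subtractf card_label_lists)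
qed

text \<open>Two replacements: \<open>play_perturb\<close> exchanges the truncated oracle for the
  full one, at the price of the probability that one of the fewer than \<open>n\<close> later points
  is queried, at most \<open>n * e\<close> by a union bound; \<open>play_take\<close> then lets the
  game run on to round \<open>T\<close>.\<close>

lemma hidden_loss_le:
  fixes e :: real
  assumes "t < T" "length ys = T" "0 \<le> e"
    and hidden: "\<And>j. blk t < j \<Longrightarrow>
      measure (measure_spmf (round_law x ys t)) {h. \<not> unaffected (\<lambda>S. x j \<notin> fst ` S) h} \<le> e"
  shows "hidden_loss x t ys - n * e
    \<le> measure (measure_spmf (play A (oracle_up_to x ys n) [] (rounds x ys))) {bs. bs ! t \<noteq> ys ! t}"
proof -
  let ?E = "{bs. bs ! t \<noteq> ys ! t}"
  define G :: "nat sample \<Rightarrow> bool" where "G = (\<lambda>S. \<forall>j\<in>{Suc (blk t)..<n}. x j \<notin> fst ` S)"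
  let ?M = "measure_spmf (round_law x ys t)"
  have "measure ?M {h. \<not> unaffected G h}
      = measure ?M (\<Union>j\<in>{Suc (blk t)..<n}. {h. \<not> unaffected (\<lambda>S. x j \<notin> fst ` S) h})"
    by (rule arg_cong[of _ _ "measure ?M"]) (auto simp: unaffected_def G_def)
  also have "\<dots> \<le> (\<Sum>j\<in>{Suc (blk t)..<n}. measure ?M {h. \<not> unaffected (\<lambda>S. x j \<notin> fst ` S) h})"
    by (rule measure_UNION_le) simp_all
  also have "\<dots> \<le> (\<Sum>j\<in>{Suc (blk t)..<n}. e)"
    by (rule sum_mono) (simp add: hidden)
  also have "\<dots> \<le> n * e"
    using assms(3) by (simp add: mult_right_mono)
  finally have touched: "measure ?M {h. \<not> unaffected G h} \<le> n * e" .
  have "hidden_loss x t ys - measure ?M {h. \<not> unaffected G h}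
    \<le> measure (measure_spmf (play A (oracle_up_to x ys n) [] (take (Suc t) (rounds x ys)))) ?E"
    unfolding hidden_loss_def round_law_def
  proof (rule play_perturb)
    fix S assume "G S"
    then show "oracle_up_to x ys n S = oracle_up_to x ys (Suc (blk t)) S"
      using blk_less[of t] by (intro hard_oracle_hides) (simp_all add: G_def)
  qed
  also have "\<dots> = measure (measure_spmf (play A (oracle_up_to x ys n) [] (rounds x ys)))
      (take (Suc t) -` ?E)"
    by (simp only: play_take[OF lossless_play[OF order_refl], symmetric] measure_map_spmf)
  also have "take (Suc t) -` ?E = ?E" by auto
  finally show ?thesis using touched by linarith
qed

lemma sum_blocks: "(\<Sum>t<T. f t) = (\<Sum>i<n. \<Sum>t\<in>block i. f t :: real)"
proof -
  have "(\<Sum>i<n. \<Sum>t | t \<in> {..<T} \<and> blk t = i. f t) = (\<Sum>t<T. f t)"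
    by (rule sum.group) (use blk_less in auto)
  then show ?thesis by (simp add: block_def)
qed

text \<open>If a block has \<open>s\<close> rounds and its labels have sign sum \<open>v\<close>,
  then \<open>(s - \<bar>v\<bar>) / 2\<close> of them differ from the majority label, and the target
  errs exactly there.\<close>

lemma target_error:
  assumes "inj x"
  shows "(\<Sum>t<T. of_bool (target x (majority ys) n (x (blk t)) \<noteq> ys ! t))
    = (T - (\<Sum>i<n. \<bar>sign_sum (block i) ys\<bar>)) / (2 :: real)"
proof -
  have "(\<Sum>t\<in>block i. of_bool (target x (majority ys) n (x (blk t)) \<noteq> ys ! t))
      = ((\<Sum>t\<in>block i. 1) - \<bar>sign_sum (block i) ys\<bar>) / 2" if "i < n" for i
  proof -
    let ?s = "if majority ys i then 1 else - 1 :: real"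
    have "target x (majority ys) n (x i) = majority ys i"
      using that assms by (intro target_eq) (auto intro: inj_on_subset)
    then have "(\<Sum>t\<in>block i. of_bool (target x (majority ys) n (x (blk t)) \<noteq> ys ! t))
        = (\<Sum>t\<in>block i. (1 - ?s * (if ys ! t then 1 else - 1)) / 2)"
      by (intro sum.cong) (auto simp: block_def)
    also have "\<dots> = ((\<Sum>t\<in>block i. 1) - ?s * sign_sum (block i) ys) / 2"
      by (simp only: sum_divide_distrib[symmetric] sum_subtractf sum_distrib_left[symmetric] sign_sum_def)
    also have "?s * sign_sum (block i) ys = \<bar>sign_sum (block i) ys\<bar>"
      by (simp add: majority_def)
    finally show ?thesis .
  qed
  then have "(\<Sum>t<T. of_bool (target x (majority ys) n (x (blk t)) \<noteq> ys ! t))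
      = (\<Sum>i<n. ((\<Sum>t\<in>block i. 1) - \<bar>sign_sum (block i) ys\<bar>) / 2)"
    unfolding sum_blocks by (intro sum.cong) simp_all
  also have "\<dots> = ((\<Sum>i<n. \<Sum>t\<in>block i. 1) - (\<Sum>i<n. \<bar>sign_sum (block i) ys\<bar>)) / 2"
    by (simp only: sum_divide_distrib[symmetric] sum_subtractf)
  finally show ?thesis using sum_blocks[of "\<lambda>_. 1"] by simp
qed

text \<open>Average over all \<open>2 ^ T\<close> label lists with \<open>x\<close> fixed. The
  learner loses at least \<open>T / 2 - T * n * e\<close>; the target loses \<open>T / 2\<close>
  minus half the sum of the block deviations, each of mean at least \<open>5 / 9 * sqrt m\<close> by
  \<open>khintchine\<close>. Halving gives 5/18.\<close>

lemma worst_case_regret_ge: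
  fixes e :: real
  assumes "0 < e" and block_size: "\<And>i. i < n \<Longrightarrow> m \<le> card (block i)"
  shows "ereal (5 / 18 * n * sqrt m - T * n * e)
    \<le> worst_case_regret UNIV (littlestone_classes UNIV d) T A"
proof -
  obtain x where x: "inj x" "\<And>j t ys. \<lbrakk>t < T; blk t < j; length ys = T\<rbrakk> \<Longrightarrow>
      measure (measure_spmf (round_law x ys t)) {h. \<not> unaffected (\<lambda>S. x j \<notin> fst ` S) h} \<le> e"
    using hidden_points[OF assms(1)] by metis
  let ?C = "\<lambda>ys. hard_class d x (majority ys) n"
  define R where "R = (\<lambda>ys. expected_regret A (?C ys) (oracle_up_to x ys n) (rounds x ys))"
  let ?B = "5 / 18 * n * sqrt m - T * n * e"
  let ?L = "{ys :: bool list. length ys = T}"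
  have R: "(\<Sum>t<T. hidden_loss x t ys - n * e) - (T - (\<Sum>i<n. \<bar>sign_sum (block i) ys\<bar>)) / 2 \<le> R ys"
    if "ys \<in> ?L" for ys
  proof -
    let ?M = "measure_spmf (play A (oracle_up_to x ys n) [] (rounds x ys))"
    have "(\<Sum>t<T. hidden_loss x t ys - n * e) \<le> (\<Sum>t<T. measure ?M {bs. bs ! t \<noteq> ys ! t})"
      using that assms(1) x(2) by (intro sum_mono hidden_loss_le) auto
    moreover have "(\<Sum>t<T. measure ?M {bs. bs ! t \<noteq> ys ! t})
        - (\<Sum>t<T. of_bool (target x (majority ys) n (x (blk t)) \<noteq> ys ! t)) \<le> R ys"
    proof -
      have "(\<Sum>t<length (rounds x ys). measure ?M {bs. bs ! t \<noteq> snd (rounds x ys ! t)})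
          - (\<Sum>t<length (rounds x ys). of_bool
              (target x (majority ys) n (fst (rounds x ys ! t)) \<noteq> snd (rounds x ys ! t))) \<le> R ys"
        unfolding R_def by (rule expected_regret_ge[OF lossless_play[OF order_refl] target_in_hard_class])
      then show ?thesis by simp
    qed
    ultimately show ?thesis unfolding target_error[OF x(1)] by linarith
  qed
  have "?B * 2 ^ T \<le> (\<Sum>t<T. 2 ^ T / 2 - 2 ^ T * (n * e))
      - (2 ^ T * real T - (\<Sum>i<n. 5 / 9 * sqrt m * 2 ^ T)) / 2"
    by (simp add: field_simps)
  also have "\<dots> \<le> (\<Sum>t<T. 2 ^ T / 2 - 2 ^ T * (n * e))
      - (2 ^ T * real T - (\<Sum>i<n. \<Sum>ys\<in>?L. \<bar>sign_sum (block i) ys\<bar>)) / 2"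
  proof -
    have "5 / 9 * sqrt m * 2 ^ T \<le> (\<Sum>ys\<in>?L. \<bar>sign_sum (block i) ys\<bar>)" if "i < n" for i
    proof -
      have "5 / 9 * sqrt m * 2 ^ T \<le> 5 / 9 * sqrt (card (block i)) * 2 ^ T"
        using block_size[OF that] by simp
      also have "\<dots> \<le> (\<Sum>ys\<in>?L. \<bar>sign_sum (block i) ys\<bar>)"
        by (rule khintchine) (auto simp: block_def)
      finally show ?thesis .
    qed
    then have "(\<Sum>i<n. 5 / 9 * sqrt m * 2 ^ T) \<le> (\<Sum>i<n. \<Sum>ys\<in>?L. \<bar>sign_sum (block i) ys\<bar>)"
      by (intro sum_mono) simp
    then show ?thesis
      by (rule diff_left_mono[OF divide_right_mono[OF diff_left_mono]]) simp
  qed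
  also have "\<dots> = (\<Sum>ys\<in>?L. (\<Sum>t<T. hidden_loss x t ys - n * e)
      - (T - (\<Sum>i<n. \<bar>sign_sum (block i) ys\<bar>)) / 2)"
  proof -
    have "(\<Sum>ys\<in>?L. \<Sum>t<T. hidden_loss x t ys - n * e) = (\<Sum>t<T. 2 ^ T / 2 - 2 ^ T * (n * e))"
      by (subst sum.swap) (simp add: sum_subtractf sum_hidden_loss card_label_lists)
    moreover have "(\<Sum>ys\<in>?L. \<Sum>i<n. \<bar>sign_sum (block i) ys\<bar>) =
        (\<Sum>i<n. \<Sum>ys\<in>?L. \<bar>sign_sum (block i) ys\<bar>)"
      by (rule sum.swap)
    ultimately show ?thesis
      by (simp only: sum_subtractf sum_divide_distrib[symmetric] sum_constant card_label_lists)
        simp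
  qed
  also have "\<dots> \<le> (\<Sum>ys\<in>?L. R ys)" by (rule sum_mono) (rule R)
  finally have sum_R: "?B * 2 ^ T \<le> (\<Sum>ys\<in>?L. R ys)" .
  \<comment> \<open>The adversary is oblivious, so one fixed label list that does at least as well
    as the average is extracted.\<close>
  obtain ys where ys: "?B \<le> R ys"
  proof -
    have "\<exists>ys\<in>?L. ?B \<le> R ys"
    proof (rule ccontr)
      assume "\<not> (\<exists>ys\<in>?L. ?B \<le> R ys)"
      then have less: "R ys < ?B" if "ys \<in> ?L" for ys
        using that by (meson not_le)
      have "replicate T True \<in> ?L" by simp
      then have "?L \<noteq> {}" by blast
      then have "(\<Sum>ys\<in>?L. R ys) < (\<Sum>ys\<in>?L. ?B)"
        by (intro sum_strict_mono less finite_label_lists)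
      with sum_R show False by (simp add: card_label_lists mult.commute)
    qed
    with that show ?thesis by metis
  qed
  have "ereal ?B \<le> ereal (R ys)" using ys by simp
  also have "\<dots> \<le> worst_case_regret UNIV (littlestone_classes UNIV d) T A"
    unfolding worst_case_regret_def R_def
    by (intro SUP_upper2[of "?C ys"] SUP_upper2[of "oracle_up_to x ys n"] SUP_upper2[of "rounds x ys"]
        hard_class_in_littlestone_classes n_less hard_oracle_in_erm_oracles order_refl)
      (simp add: sequences_def)
  finally show ?thesis .
qed

end

section \<open>Choice of the parameters\<close>

theorem theorem3p2:
  shows "\<exists>c::real. c > 0 \<and>
    (\<forall>d::nat. d \<ge> 1 \<longrightarrow>
      (\<exists>X::nat set. \<exists>T0::nat. \<forall>T\<ge>T0. \<forall>A :: nat learner.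
         admissible_learner X A \<and> finitely_many_queries X (littlestone_classes X d) T A \<longrightarrow>
         worst_case_regret X (littlestone_classes X d) T A \<ge> ereal (c * sqrt (real T * 2 ^ d))))"
proof (intro exI[of _ "1 / 9 :: real"] conjI allI impI)
  fix d :: nat assume "1 \<le> d"
  define n :: nat where "n = 2 ^ (d - 1)"
  have n: "0 < n" "2 ^ d = 2 * n"
    using \<open>1 \<le> d\<close> by (simp_all add: n_def power_Suc[symmetric] del: power_Suc)
  show "\<exists>X::nat set. \<exists>T0::nat. \<forall>T\<ge>T0. \<forall>A :: nat learner.
      admissible_learner X A \<and> finitely_many_queries X (littlestone_classes X d) T A \<longrightarrow>
      ereal (1 / 9 * sqrt (real T * 2 ^ d)) \<le> worst_case_regret X (littlestone_classes X d) T A"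
  \<comment> \<open>The threshold \<open>n\<close> suffices: for \<open>T \<ge> n\<close> no block
    is empty, and rounding down in \<open>T div n\<close> costs less than a factor 2.\<close>
  proof (rule exI[of _ UNIV], rule exI[of _ n], intro allI impI, elim conjE)
    fix T :: nat and A :: "nat learner"
    assume T: "n \<le> T" and A: "admissible_learner UNIV A"
      "finitely_many_queries UNIV (littlestone_classes UNIV d) T A"
    define m where "m = T div n"
    define r where "r = sqrt (real T * 2 ^ d)"
    have m: "0 < m" "n * m \<le> T" "T < 2 * (n * m)"
    proof -
      show "0 < m" using T n(1) by (simp add: m_def div_greater_zero_iff)
      then have "n \<le> n * m" by simp
      moreover have "T = n * m + T mod n" by (simp add: m_def)
      moreover have "T mod n < n" using n(1) by simp
      ultimately show "n * m \<le> T" "T < 2 * (n * m)" by linarith+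
    qed
    have r: "0 < r" using T n(1) by (simp add: r_def)
    \<comment> \<open>Blocks have \<open>m\<close> rounds each, and the last one also absorbs the
      rounds from \<open>n * m\<close> on.\<close>
    interpret blocked_game A d n T "\<lambda>t. min (t div m) (n - 1)"
    proof
      show "mono (\<lambda>t. min (t div m) (n - 1))"
        by (intro monoI min.mono div_le_mono order_refl)
    qed (use A n in auto)
    have "m \<le> card (block i)" if "i < n" for i
    proof -
      have "{i * m..<Suc i * m} \<subseteq> block i"
      proof
        fix t assume t: "t \<in> {i * m..<Suc i * m}"
        then have "t div m = i" using div_nat_eqI[of m i t] by (simp add: mult.commute)
        moreover have "Suc i * m \<le> n * m" using that by (intro mult_le_mono1) simp
        then have "t < T" using t m(2) by simp
        ultimately show "t \<in> block i" unfolding block_def using that by simp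
      qed
      then have "card {i * m..<Suc i * m} \<le> card (block i)"
        by (rule card_mono[OF finite_block])
      then show ?thesis by simp
    qed
    \<comment> \<open>The choice \<open>e = r / (36 * T * n)\<close> makes the total cost of hiding
      equal to \<open>r / 36\<close>.\<close>
    then have "ereal (5 / 18 * n * sqrt m - T * n * (r / (36 * T * n)))
        \<le> worst_case_regret UNIV (littlestone_classes UNIV d) T A"
      using r T n(1) by (intro worst_case_regret_ge) simp_all
    \<comment> \<open>Since \<open>r \<le> 2 * n * sqrt m\<close>, the main term is at least
      \<open>5 / 36 * r\<close>; subtracting \<open>r / 36\<close> leaves
      \<open>r / 9\<close>.\<close>
    moreover have "1 / 9 * r \<le> 5 / 18 * n * sqrt m - T * n * (r / (36 * T * n))"
    proof -
      have "real T \<le> real (2 * (n * m))" using m(3) by (simp only: of_nat_le_iff)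
      moreover have "(2 :: real) ^ d = real (2 * n)"
        by (simp only: n(2)[symmetric] of_nat_power of_nat_numeral)
      ultimately have "real T * 2 ^ d \<le> real (2 * (n * m)) * real (2 * n)"
        by (intro mult_mono) simp_all
      then have "r \<le> sqrt ((2 * n) ^ 2 * m)"
        unfolding r_def by (intro real_sqrt_le_mono) (simp add: power2_eq_square mult_ac)
      also have "\<dots> = 2 * n * sqrt m" by (simp add: real_sqrt_mult)
      finally have "r \<le> 2 * n * sqrt m" .
      moreover have "T * n * (r / (36 * T * n)) = r / 36" using T n(1) by simp
      ultimately show ?thesis by simp
    qed
    ultimately show "ereal (1 / 9 * sqrt (real T * 2 ^ d))
        \<le> worst_case_regret UNIV (littlestone_classes UNIV d) T A"
      unfolding r_def[symmetric] by (meson ereal_less_eq(3) order_trans)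
  qed
qed simp

end
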